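(* Let $q$ be a prime power and $m$ a positive integer. If there exists an $[\mathcal F,k,\delta]_{q^m}$ code, where $\mathcal F=[\gamma_0,\gamma_1,\ldots,\gamma_{n-1}]$ is a Ferrers diagram, then there exists an $[\mathcal F',mk,\delta]_q$ code, where $\mathcal F'=[m\gamma_0,m\gamma_1,\ldots,m\gamma_{n-1}]$.
   Context: Ferrers diagrams. For positive integers $a,n$, an $a\times n$ Ferrers diagram is an $a\times n$ array of dots and empty cells such that all dots are shifted to the right, the number of dots in each row is at most the number of dots in the previous row, the first row has $n$ dots and the rightmost column has $a$ dots. It is identified with its column cardinalities: $\mathcal F=[\gamma_0,\gamma_1,\ldots,\gamma_{n-1}]$ with $1\leq\gamma_0\leq\gamma_1\leq\cdots\leq\gamma_{n-1}=a$, where the $(j+1)$-th column from the left has exactly $\gamma_j$ dots, located in its top $\gamma_j$ cells. Codes. For an $a\times n$ Ferrers diagram $\mathcal F$ and a prime power $Q$, an $[\mathcal F,k,\delta]_Q$ code (Ferrers diagram rank-metric code) is a $k$-dimensional $\mathbb F_Q$-linear subspace of $\mathbb F_Q^{a\times n}$ with minimum rank distance $\delta$ (the minimum of the ranks over $\mathbb F_Q$ of its nonzero matrices), such that in every matrix of the code all entries at positions not in $\mathcal F$ are zero. *)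

theory Defs
  imports
    "Jordan_Normal_Form.DL_Rank"
    "HOL-Library.Cardinality"
    "HOL-Number_Theory.Prime_Powers"
begin

text \<open>
  An \<open>a \<times> n\<close> Ferrers diagram is given by its list of column cardinalities, read from left to
  right. The dots are top-justified within the columns, and rows and columns are indexed from 0,
  as in \<open>'a mat\<close>.
\<close>

definition ferrers_diagram :: "nat \<Rightarrow> nat \<Rightarrow> nat list \<Rightarrow> bool" where
  "ferrers_diagram a n \<gamma> \<longleftrightarrow>
     a > 0 \<and> n > 0 \<and> length \<gamma> = n \<and> sorted \<gamma> \<and> 1 \<le> \<gamma> ! 0 \<and> \<gamma> ! (n - 1) = a"

definition ferrers_dots :: "nat list \<Rightarrow> (nat \<times> nat) set" where
  "ferrers_dots \<gamma> = {(i, j). j < length \<gamma> \<and> i < \<gamma> ! j}"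

text \<open>
  The ranks of the nonzero matrices of a set of \<open>a \<times> n\<close> matrices. The parameter of
  \<open>vec_space.rank\<close> is the dimension of the column vectors, that is, the number of rows.
\<close>

definition nonzero_ranks :: "nat \<Rightarrow> nat \<Rightarrow> 'a::field mat set \<Rightarrow> nat set" where
  "nonzero_ranks a n C = vec_space.rank a ` (C - {0\<^sub>m a n})"

text \<open>
  The minimum rank distance is the least element of \<^term>\<open>nonzero_ranks a n C\<close>. Since this least
  element has to exist, the zero code has no minimum rank distance.
\<close>

definition min_rank_distance :: "nat \<Rightarrow> nat \<Rightarrow> 'a::field mat set \<Rightarrow> nat \<Rightarrow> bool" where
  "min_rank_distance a n C \<delta> \<longleftrightarrow>
     \<delta> \<in> nonzero_ranks a n C \<and> (\<forall>r \<in> nonzero_ranks a n C. \<delta> \<le> r)"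

text \<open>
  \<open>C\<close> is an \<open>[\<F>, k, \<delta>]\<^sub>Q\<close> code, where \<open>\<F>\<close> is the \<open>a \<times> n\<close> Ferrers diagram \<open>\<gamma>\<close> and the field
  with \<open>Q\<close> elements is the type \<open>'a\<close>, so that \<open>Q = CARD('a)\<close>.
\<close>

definition ferrers_code ::
  "nat \<Rightarrow> nat \<Rightarrow> nat list \<Rightarrow> nat \<Rightarrow> nat \<Rightarrow> 'a::{field,finite} mat set \<Rightarrow> bool" where
  "ferrers_code a n \<gamma> k \<delta> C \<longleftrightarrow>
     ferrers_diagram a n \<gamma> \<and>
     VectorSpace.subspace class_ring C (module_mat TYPE('a) a n) \<and>
     vectorspace.dim class_ring ((module_mat TYPE('a) a n)\<lparr>carrier := C\<rparr>) = k \<and>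
     min_rank_distance a n C \<delta> \<and>
     (\<forall>M \<in> C. \<forall>i < a. \<forall>j < n. (i, j) \<notin> ferrers_dots \<gamma> \<longrightarrow> M $$ (i, j) = 0)"

end

theory Submission
  imports
    Defs
    "HOL-Algebra.Multiplicative_Group"
    "HOL-Number_Theory.Residues"
    "Jordan_Normal_Form.Char_Poly"
begin

text \<open>
  Fix a basis of the big field over the small one and replace every entry of a codeword by the column
  of its \<open>m\<close> coordinates. This map is injective and linear over the small field, and it does not lower
  the rank, since columns that are independent over the big field stay independent over the small one.
  It may raise the rank of every codeword, however (the row \<open>(1, w)\<close> with \<open>w\<close> outside the small field
  goes from rank 1 to rank 2), so the minimum distance may become too large. To bring it down to
  \<open>\<delta>\<close>, the columns are set to zero one after another: each step lowers a rank by at most one, and the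
  last one reaches the zero matrix. As long as the distance is positive, no codeword is lost.
\<close>


section \<open>Finite fields: embedding the small field into the big one\<close>

lemma finite_field_primitive_element:
  obtains g :: "'a::{field,finite}" where "\<And>x. x \<noteq> 0 \<Longrightarrow> \<exists>i. x = g ^ i"
proof -
  have fin: "finite (carrier (class_ring :: 'a ring))"
    by simp
  obtain g :: 'a where
    g: "carrier (mult_of (class_ring :: 'a ring)) = {g [^]\<^bsub>class_ring\<^esub> i | i::nat. i \<in> UNIV}"
    using field.finite_field_mult_group_has_gen[OF class_field fin] by blast
  show ?thesis
  proof (rule that[of g])
    fix x :: 'a assume "x \<noteq> 0"
    then have "x \<in> carrier (mult_of class_ring)" by simp
    then show "\<exists>i. x = g ^ i"
      unfolding g by (auto simp: class_ring_simps)
  qed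
qed

text \<open>Lagrange in the multiplicative group, with one more factor \<open>x\<close> so that 0 is
  covered too. The exponent \<open>n\<close> lets one identity serve both fields, since
  \<open>CARD('Q)\<close> is itself a power of \<open>CARD('q)\<close>.\<close>

lemma finite_field_power_card:
  fixes x :: "'a::{field,finite}"
  shows "x ^ (CARD('a) ^ n) = x"
proof -
  have 1: "x ^ CARD('a) = x"
  proof (cases "x = 0")
    case False
    let ?G = "mult_of (class_ring :: 'a ring)"
    have "x [^]\<^bsub>?G\<^esub> Coset.order ?G = \<one>\<^bsub>?G\<^esub>"
      using False by (intro group.pow_order_eq_1 field.field_mult_group class_field) auto
    then have "x ^ (CARD('a) - 1) = 1"
      by (simp add: Coset.order_def nat_pow_mult_of class_ring_simps card_Diff_singleton)
    then have "x ^ Suc (CARD('a) - 1) = x"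
      by (simp only: power_Suc mult_1_right)
    moreover have "Suc (CARD('a) - 1) = CARD('a)"
      by simp
    ultimately show ?thesis
      by simp
  qed simp
  show ?thesis
    by (induction n) (simp_all add: 1 power_mult)
qed

text \<open>Each characteristic is a prime dividing a power of the same prime \<open>p\<close>.
  Hence an integer vanishes in one field exactly when it vanishes in the other, which lets integer
  polynomials mediate between them.\<close>

lemma CHAR_eq_if_CARD_power:
  assumes "primepow (CARD('q::{field,finite}))"
    and "CARD('Q::{field,finite}) = CARD('q) ^ m"
  shows "CHAR('Q) = CHAR('q)"
proof -
  obtain p k where pk: "prime p" "CARD('q) = p ^ k"
    using assms(1) unfolding primepow_def by auto
  have "prime CHAR('q)" "prime CHAR('Q)"
    by (intro prime_CHAR_semidom finite_imp_CHAR_pos; simp)+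
  moreover have "CHAR('q) dvd p ^ k" "CHAR('Q) dvd p ^ (k * m)"
    using CHAR_dvd_CARD[where 'a='q] CHAR_dvd_CARD[where 'a='Q] assms(2) pk(2)
    by (simp_all add: power_mult)
  ultimately show ?thesis
    using pk(1) by (metis prime_dvd_power primes_dvd_imp_eq)
qed

text \<open>
  The second field is not an extension of the first one by construction. Evaluation of integer
  polynomials at a generator \<open>g\<close> presents the small field as a quotient; \<open>F\<close> below reduces to a
  multiple of the minimal polynomial of \<open>g\<close> by a nonzero scalar of the prime field, and a root of
  \<open>F\<close> in the big field is the image of \<open>g\<close>.
\<close>

lemma finite_field_common_root:
  fixes g :: "'q::{field,finite}"
  assumes "primepow (CARD('q))" and "CARD('Q::{field,finite}) = CARD('q) ^ m"
  obtains b :: "'Q::{field,finite}" where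
    "\<And>P. poly (of_int_poly P) g = 0 \<Longrightarrow> poly (of_int_poly P) b = 0"
proof -
  let ?q = "of_int_poly :: int poly \<Rightarrow> 'q poly"
  let ?Q = "of_int_poly :: int poly \<Rightarrow> 'Q poly"
  have of_int_0_iff: "of_int c = (0::'Q) \<longleftrightarrow> of_int c = (0::'q)" for c
    by (simp add: of_int_eq_0_iff_char_dvd CHAR_eq_if_CARD_power[OF assms])
  \<comment> \<open>X^N - X with N = \<open>CARD('Q)\<close> vanishes at \<open>g\<close> and on all
    of \<open>'Q\<close>: it makes \<open>S\<close> nonempty and later supplies the roots for a
    counting argument.\<close>
  define P\<^sub>0 :: "int poly" where "P\<^sub>0 = Polynomial.monom 1 (CARD('Q)) - Polynomial.monom 1 1"
  \<comment> \<open>Testing the leading coefficient in \<open>'Q\<close> keeps the degree under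
    reduction and makes that coefficient invertible there for the division below.\<close>
  define S where "S = {F. poly (?q F) g = 0 \<and> of_int (lead_coeff F) \<noteq> (0::'Q)}"
  have card_gt_1: "CARD('Q) > 1"
    using card_mono[of UNIV "{0, 1::'Q}"] by simp
  have P0_Q: "?Q P\<^sub>0 = Polynomial.monom 1 (CARD('Q)) - Polynomial.monom 1 1"
    by (simp add: P\<^sub>0_def of_int_poly_hom.hom_minus)
  have P0_root: "poly (?q P\<^sub>0) g = 0"
    using finite_field_power_card[of g m]
    by (simp add: P\<^sub>0_def of_int_poly_hom.hom_minus poly_monom assms(2))
  have "degree P\<^sub>0 = CARD('Q)"
    unfolding P\<^sub>0_def using card_gt_1
    by (subst diff_conv_add_uminus, subst degree_add_eq_left) (simp_all add: degree_monom_eq)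
  then have "P\<^sub>0 \<in> S"
    using card_gt_1 P0_root by (simp add: S_def P\<^sub>0_def)
  then obtain F where F: "F \<in> S" and F_min: "\<And>G. G \<in> S \<Longrightarrow> degree F \<le> degree G"
    using that[of "arg_min degree (\<lambda>G. G \<in> S)"] arg_min_natI[of "\<lambda>G. G \<in> S"]
      arg_min_nat_le[of "\<lambda>G. G \<in> S" _ degree] by blast
  have F_root: "poly (?q F) g = 0" and F_lead: "of_int (lead_coeff F) \<noteq> (0::'Q)"
    using F by (auto simp: S_def)
  \<comment> \<open>Induction on a bound for the coefficients instead of the degree:
    \<open>n = 0\<close> then means \<open>P = 0\<close>, and a step only has to clear the
    coefficient at \<open>n\<close>.\<close>
  have F_dvd: "?Q F dvd ?Q P" if "poly (?q P) g = 0" "\<forall>i\<ge>n. Polynomial.coeff P i = 0" for P n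
    using that
  proof (induction n arbitrary: P)
    case 0
    then have "P = 0" by (simp add: poly_eq_iff)
    then show ?case by simp
  next
    case (Suc n)
    define c where "c = Polynomial.coeff P n"
    show ?case
    proof (cases "of_int c = (0::'Q)")
      case True
      \<comment> \<open>The top coefficient is zero in both fields, so dropping it changes neither
        reduction.\<close>
      define P' where "P' = P - Polynomial.monom c n"
      have "?q (Polynomial.monom c n) = 0" "?Q (Polynomial.monom c n) = 0"
        using True of_int_0_iff[of c] by (simp_all add: of_int_hom.map_poly_hom_monom)
      then have "?q P' = ?q P" "?Q P' = ?Q P"
        by (simp_all add: P'_def of_int_poly_hom.hom_minus)
      moreover have "Polynomial.coeff P' i = 0" if "i \<ge> n" for i
        using Suc.prems(2) that by (cases "i = n") (simp_all add: P'_def c_def coeff_monom)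
      ultimately show ?thesis
        using Suc.IH[of P'] Suc.prems(1) by simp
    next
      case False
      have "degree P = n"
      proof (rule antisym)
        show "degree P \<le> n"
          using Suc.prems(2) by (intro degree_le) auto
        show "n \<le> degree P"
          using False by (intro le_degree) (auto simp: c_def)
      qed
      then have "P \<in> S"
        using Suc.prems(1) False by (simp add: S_def c_def)
      then have le: "degree F \<le> n"
        using F_min \<open>degree P = n\<close> by blast
      \<comment> \<open>Pseudo-division: over the integers the leading coefficient of
        \<open>F\<close> need not be invertible, so \<open>P\<close> is scaled by it before the
        coefficient at \<open>n\<close> is cancelled. The scalar is a unit in \<open>'Q\<close> and
        is removed at the end.\<close>
      define P' where "P' = smult (lead_coeff F) P - Polynomial.monom c (n - degree F) * F"
      have "\<forall>i\<ge>n. Polynomial.coeff P' i = 0"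
      proof (intro allI impI)
        fix i assume "n \<le> i"
        then consider "i = n" | "i \<ge> Suc n" by linarith
        then show "Polynomial.coeff P' i = 0"
        proof cases
          case 1
          then show ?thesis
            using le by (simp add: P'_def coeff_monom_mult c_def)
        next
          case 2
          then show ?thesis
            using le Suc.prems(2) by (simp add: P'_def coeff_monom_mult coeff_eq_0)
        qed
      qed
      moreover have "poly (?q P') g = 0"
        using Suc.prems(1) F_root
        by (simp add: P'_def of_int_poly_hom.hom_minus of_int_poly_hom.hom_mult
            of_int_hom.map_poly_hom_smult)
      ultimately have "?Q F dvd ?Q P'"
        using Suc.IH by blast
      moreover have "?Q P' = smult (of_int (lead_coeff F)) (?Q P) - ?Q (Polynomial.monom c (n - degree F)) * ?Q F"
        by (simp add: P'_def of_int_poly_hom.hom_minus of_int_poly_hom.hom_mult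
            of_int_hom.map_poly_hom_smult)
      ultimately have "?Q F dvd smult (of_int (lead_coeff F)) (?Q P)"
        by (metis dvd_diff_left_iff dvd_triv_right)
      then show ?thesis
        using F_lead by (simp add: dvd_smult_iff)
    qed
  qed
  have dvd: "?Q F dvd ?Q P" if "poly (?q P) g = 0" for P
    using F_dvd[OF that, of "Suc (degree P)"] by (simp add: coeff_eq_0)
  \<comment> \<open>Without a root of \<open>F\<close> in \<open>'Q\<close>, its cofactor in X^N - X
    would vanish on all of \<open>'Q\<close>. Counting roots leaves degree 0 for \<open>F\<close>,
    and a constant that vanishes at \<open>g\<close> is zero in both fields.\<close>
  obtain b where b: "poly (?Q F) b = 0"
  proof (rule ccontr)
    assume "\<not> thesis"
    then have no_root: "poly (?Q F) a \<noteq> 0" for a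
      using that by blast
    obtain H where H: "?Q P\<^sub>0 = ?Q F * H"
      using dvd[OF P0_root] by (elim dvdE)
    have deg_Q: "degree (?Q P\<^sub>0) = CARD('Q)"
      unfolding P0_Q using card_gt_1
      by (subst diff_conv_add_uminus, subst degree_add_eq_left) (simp_all add: degree_monom_eq)
    have zero: "poly (?Q P\<^sub>0) a = 0" for a
      using finite_field_power_card[of a 1] unfolding P0_Q by (simp add: poly_monom)
    then have "poly H a = 0" for a
      using no_root[of a] zero[of a] unfolding H by simp
    then have "{a. poly H a = 0} = UNIV"
      by simp
    moreover have nz: "?Q F \<noteq> 0" "H \<noteq> 0"
      using deg_Q H card_gt_1 by auto
    ultimately have "CARD('Q) \<le> degree H"
      using card_poly_roots_bound[of H] by simp
    moreover have "degree (?Q F) + degree H = CARD('Q)"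
      using deg_Q nz unfolding H by (simp add: degree_mult_eq)
    moreover have "degree (?Q F) = degree F"
      using F_lead by (intro degree_map_poly) auto
    ultimately have "degree F = 0"
      by simp
    then obtain c where c: "F = [:c:]"
      by (elim degree_eq_zeroE)
    then have "?q F = [:of_int c:]"
      by (simp add: poly_eq_iff coeff_map_poly coeff_pCons split: nat.split)
    then show False
      using F_root F_lead of_int_0_iff[of c] c by simp
  qed
  show ?thesis
    using that[of b] dvd b by (metis dvd_def mult_zero_left poly_mult)
qed

text \<open>Write each element as an integer polynomial in the generator \<open>g\<close> and
  evaluate the same polynomial at \<open>b\<close>.\<close>

lemma finite_field_embedding:
  assumes "primepow (CARD('q::{field,finite}))" and "CARD('Q::{field,finite}) = CARD('q) ^ m"
  obtains \<phi> :: "'q::{field,finite} \<Rightarrow> 'Q::{field,finite}" where "field_hom \<phi>"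
proof -
  obtain g :: 'q where g: "\<And>x. x \<noteq> 0 \<Longrightarrow> \<exists>i. x = g ^ i"
    using finite_field_primitive_element by blast
  obtain b :: 'Q where b: "\<And>P. poly (of_int_poly P) g = 0 \<Longrightarrow> poly (of_int_poly P) b = 0"
    using finite_field_common_root[OF assms] by blast
  have "\<exists>P. poly (of_int_poly P) g = x" for x
  proof (cases "x = 0")
    case False
    then obtain i where "x = g ^ i"
      using g by blast
    then have "poly (of_int_poly (Polynomial.monom 1 i)) g = x"
      by (simp add: poly_monom)
    then show ?thesis ..
  qed (auto intro: exI[of _ 0])
  then obtain R where R: "\<And>x. poly (of_int_poly (R x)) g = x"
    by metis
  define \<phi> where "\<phi> x = poly (of_int_poly (R x)) b" for x
  \<comment> \<open>The choice of \<open>R x\<close> does not matter: two polynomials agreeing at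
    \<open>g\<close> differ by one that vanishes at \<open>g\<close>, hence at \<open>b\<close>. So
    sums and products of representatives may be used freely.\<close>
  have \<phi>: "\<phi> (poly (of_int_poly P) g) = poly (of_int_poly P) b" for P
    using b[of "R (poly (of_int_poly P) g) - P"] R[of "poly (of_int_poly P) g"]
    by (simp add: \<phi>_def of_int_poly_hom.hom_minus)
  have "\<phi> (x + y) = \<phi> x + \<phi> y" "\<phi> (x * y) = \<phi> x * \<phi> y" for x y
    using \<phi>[of "R x + R y"] \<phi>[of "R x * R y"]
    by (simp_all add: R \<phi>_def[symmetric] of_int_poly_hom.hom_add of_int_poly_hom.hom_mult)
  moreover have "\<phi> 0 = 0" "\<phi> 1 = 1"
    using \<phi>[of 0] \<phi>[of 1] by simp_all
  ultimately have "field_hom \<phi>"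
    by unfold_locales
  then show ?thesis
    by (rule that)
qed


section \<open>Dimension by counting, and rank by independent sets of columns\<close>

text \<open>Coordinates in a basis biject the space with coefficient functions. The dimension of the
  new code can thus be found by counting codewords, with no basis of it constructed.\<close>

lemma (in vectorspace) card_carrier_eq_power_dim:
  assumes "finite (carrier V)"
  shows "card (carrier V) = card (carrier K) ^ dim"
proof -
  have "gen_set (carrier V)"
    using in_own_span span_is_subset2 by blast
  then have fin_dim
    using assms unfolding fin_dim_def by blast
  then obtain \<beta> where \<beta>: "finite \<beta>" "basis \<beta>"
    using finite_basis_exists by blast
  then have sub: "\<beta> \<subseteq> carrier V"
    by (simp add: basis_def)
  \<comment> \<open>Extensional functions have a fixed value off \<beta>; otherwise the coefficients
    would not be unique.\<close>
  have ex1: "\<exists>!a. a \<in> \<beta> \<rightarrow>\<^sub>E carrier K \<and> lincomb a \<beta> = v" if "v \<in> carrier V" for v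
    using basis_criterion[OF \<beta>(1) sub] \<beta>(2) that by blast
  have closed: "lincomb a \<beta> \<in> carrier V" if "a \<in> \<beta> \<rightarrow>\<^sub>E carrier K" for a
    using that sub by (intro lincomb_closed) auto
  have "bij_betw (\<lambda>a. lincomb a \<beta>) (\<beta> \<rightarrow>\<^sub>E carrier K) (carrier V)"
    unfolding bij_betw_def
  proof
    show "inj_on (\<lambda>a. lincomb a \<beta>) (\<beta> \<rightarrow>\<^sub>E carrier K)"
      using ex1 closed by (intro inj_onI) metis
    show "(\<lambda>a. lincomb a \<beta>) ` (\<beta> \<rightarrow>\<^sub>E carrier K) = carrier V"
      using ex1 closed by (auto simp: image_iff) metis
  qed
  then have "card (carrier V) = card (\<beta> \<rightarrow>\<^sub>E carrier K)"
    by (rule bij_betw_same_card[symmetric])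
  then show ?thesis
    using \<beta> by (simp add: card_PiE dim_basis)
qed

context vec_space
begin

text \<open>A maximal independent set of columns, grown from the empty set, witnesses the rank. The
  rank inequalities below move such a set to another matrix.\<close>

lemma obtain_indpt_cols:
  assumes "A \<in> carrier_mat n nc"
  obtains S where "S \<subseteq> set (cols A)" "lin_indpt S" "card S = rank A"
proof -
  have "lin_indpt {}"
    by (simp add: lin_dep_def)
  then obtain S where S: "maximal S (\<lambda>T. T \<subseteq> set (cols A) \<and> lin_indpt T)"
    using maximal_exists_superset[of "set (cols A)" "\<lambda>T. T \<subseteq> set (cols A) \<and> lin_indpt T" "{}"]
    by auto
  then have "S \<subseteq> set (cols A)" "lin_indpt S"
    by (auto simp: maximal_def)
  then show ?thesis
    using that rank_card_indpt[OF assms S] by simp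
qed

lemma zero_notin_indpt:
  assumes "lin_indpt S"
  shows "0\<^sub>v n \<notin> S"
proof -
  have "(UNIV :: 'a set) \<noteq> {0}"
    by (metis UNIV_I singletonD zero_neq_one)
  then show ?thesis
    using zero_lin_dep assms by blast
qed

lemma rank_zero_mat: "rank (0\<^sub>m n nc) = 0"
proof -
  obtain S where S: "S \<subseteq> set (cols (0\<^sub>m n nc :: 'a mat))" "lin_indpt S"
    "card S = rank (0\<^sub>m n nc)"
    using obtain_indpt_cols[of "0\<^sub>m n nc" nc] by auto
  have "S \<subseteq> {0\<^sub>v n}"
    using S(1) by (auto simp: cols_def)
  moreover have "0\<^sub>v n \<notin> S"
    using S(2) by (rule zero_notin_indpt)
  ultimately have "S = {}"
    by blast
  then show ?thesis
    using S(3) by simp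
qed

lemma rank_pos:
  assumes "A \<in> carrier_mat n nc" and "A \<noteq> 0\<^sub>m n nc"
  shows "rank A > 0"
proof -
  obtain i j where ij: "i < n" "j < nc" "A $$ (i, j) \<noteq> 0"
    using assms by (metis carrier_matD eq_matI index_zero_mat)
  have "lin_indpt {col A j}"
  proof (rule finite_lin_indpt2)
    fix a assume "lincomb a {col A j} = 0\<^sub>v n"
    then have "(\<Sum>x\<in>{col A j}. a x * x $ i) = 0"
      using lincomb_index[OF ij(1), of "{col A j}" a] col_dim[of A j] assms(1) ij(1) by simp
    moreover have "col A j $ i \<noteq> 0"
      using assms(1) ij by simp
    ultimately show "\<forall>v\<in>{col A j}. a v = 0"
      by simp
  qed (use assms(1) ij in auto)
  moreover have "{col A j} \<subseteq> set (cols A)"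
    using assms(1) ij(2) by (auto simp: cols_def)
  ultimately show ?thesis
    using rank_ge_card_indpt[OF assms(1), of "{col A j}"] by simp
qed

end

section \<open>Clearing the leading columns of a matrix\<close>

text \<open>Columns are cleared rather than deleted, so the shape stays and no entry outside the
  diagram appears. The counter \<open>t\<close> gives a chain from \<open>A\<close> itself to the
  zero matrix.\<close>

definition zero_first_cols :: "nat \<Rightarrow> 'a::zero mat \<Rightarrow> 'a mat" where
  "zero_first_cols t A = mat (dim_row A) (dim_col A) (\<lambda>(i, j). if j < t then 0 else A $$ (i, j))"

lemma zero_first_cols_carrier [simp]:
  "A \<in> carrier_mat nr nc \<Longrightarrow> zero_first_cols t A \<in> carrier_mat nr nc"
  by (simp add: zero_first_cols_def)

lemma zero_first_cols_0 [simp]: "zero_first_cols 0 A = A"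
  by (auto simp: zero_first_cols_def)

lemma zero_first_cols_all:
  "A \<in> carrier_mat nr nc \<Longrightarrow> zero_first_cols nc A = 0\<^sub>m nr nc"
  by (auto simp: zero_first_cols_def)

lemma col_zero_first_cols:
  assumes "A \<in> carrier_mat nr nc" and "j < nc"
  shows "col (zero_first_cols t A) j = (if j < t then 0\<^sub>v nr else col A j)"
  using assms by (auto simp: zero_first_cols_def)

text \<open>The distance is attained at a nonzero matrix. Positivity ensures that clearing columns
  eventually falls below \<delta>, and that the final map is injective.\<close>

lemma min_rank_distance_pos:
  assumes C: "C \<subseteq> carrier_mat a n" and dist: "min_rank_distance a n C \<delta>"
  shows "\<delta> > 0"
proof -
  obtain M where M: "M \<in> C - {0\<^sub>m a n}" "\<delta> = vec_space.rank a M"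
    using dist by (auto simp: min_rank_distance_def nonzero_ranks_def)
  then have "M \<in> carrier_mat a n"
    using C by auto
  then show ?thesis
    using vec_space.rank_pos[of M a n] M by simp
qed

text \<open>Passing from \<open>t\<close> to \<open>Suc t\<close> costs an independent set of
  columns at most the vector \<open>col A t\<close>.\<close>

lemma (in vec_space) rank_zero_first_cols_Suc:
  assumes A: "A \<in> carrier_mat n nc"
  shows "rank (zero_first_cols t A) \<le> Suc (rank (zero_first_cols (Suc t) A))"
proof -
  obtain S where S: "S \<subseteq> set (cols (zero_first_cols t A))" "lin_indpt S"
    "card S = rank (zero_first_cols t A)"
    using obtain_indpt_cols[of "zero_first_cols t A" nc] A by auto
  have fin: "finite S"
    using S(1) finite_subset by blast
  have nz: "0\<^sub>v n \<notin> S"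
    using S(2) by (rule zero_notin_indpt)
  have "S - {col A t} \<subseteq> set (cols (zero_first_cols (Suc t) A))"
  proof
    fix v assume v: "v \<in> S - {col A t}"
    then obtain j where j: "j < nc" "v = col (zero_first_cols t A) j"
      using S(1) A by (auto simp: cols_def zero_first_cols_def)
    \<comment> \<open>Vectors of \<open>S\<close> are nonzero, which excludes the cleared columns
      \<open>j < t\<close>; the removal of \<open>col A t\<close> excludes
      \<open>j = t\<close>.\<close>
    then have "\<not> j < t" "j \<noteq> t"
      using v nz A by (auto simp: col_zero_first_cols split: if_splits)
    then have "v = col (zero_first_cols (Suc t) A) j"
      using j A by (simp add: col_zero_first_cols)
    then show "v \<in> set (cols (zero_first_cols (Suc t) A))"
      using j(1) A by (auto simp: cols_def zero_first_cols_def)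
  qed
  moreover have "lin_indpt (S - {col A t})"
    using S(2) by (meson Diff_subset subset_li_is_li)
  ultimately have "card (S - {col A t}) \<le> rank (zero_first_cols (Suc t) A)"
    using A by (intro rank_ge_card_indpt[of _ nc]) simp_all
  moreover have "card S \<le> Suc (card (S - {col A t}))"
  proof -
    have "card S \<le> card (insert (col A t) (S - {col A t}))"
      using fin by (intro card_mono) auto
    also have "\<dots> \<le> Suc (card (S - {col A t}))"
      using fin by (subst card_insert_if) auto
    finally show ?thesis .
  qed
  ultimately show ?thesis
    using S(3) by simp
qed

section \<open>Restriction of scalars: expanding entries into coordinate blocks\<close>

lemma div_less_of_less_mult: "i < m * k \<Longrightarrow> i div m < (k :: nat)"
  by (simp add: less_mult_imp_div_less mult.commute)

lemma mult_add_less_mult: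
  assumes "i < n" and "k < (m :: nat)"
  shows "i * m + k < m * n"
proof -
  have "i * m + k < Suc i * m"
    using assms(2) by simp
  also have "\<dots> \<le> n * m"
    using assms(1) by (intro mult_le_mono1) simp
  finally show ?thesis
    by (simp add: mult.commute)
qed

text \<open>\<open>'Q\<close> is seen as a space over \<open>'q\<close> with scalars acting through
  \<phi>, and \<open>coord x i\<close> stands for a coordinate in a basis of \<open>m\<close>
  elements. The rank argument can then proceed without naming the basis.\<close>

locale restriction_of_scalars = field_hom \<phi>
  for \<phi> :: "'q::field \<Rightarrow> 'Q::field" +
  fixes m :: nat and coord :: "'Q \<Rightarrow> nat \<Rightarrow> 'q"
  assumes coord_add: "coord (x + y) i = coord x i + coord y i"
    and coord_scale: "coord (\<phi> c * x) i = c * coord x i"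
    and coord_eq_0: "(\<And>i. i < m \<Longrightarrow> coord x i = 0) \<Longrightarrow> x = 0"

lemma (in field_hom) vector_space_scale: "vector_space (\<lambda>c x. hom c * x)"
  by unfold_locales (simp_all add: algebra_simps hom_add hom_mult)

text \<open>Extending the empty set gives a basis \<open>B\<close>; it has \<open>m\<close> elements
  because \<open>'Q\<close> has \<open>CARD('q) ^ card B\<close> elements.\<close>

lemma restriction_of_scalars_exists:
  fixes \<phi> :: "'q::{field,finite} \<Rightarrow> 'Q::{field,finite}"
  assumes "field_hom \<phi>" and "CARD('Q) = CARD('q) ^ m"
  obtains coord where "restriction_of_scalars \<phi> m coord"
proof -
  interpret field_hom \<phi> by fact
  interpret vs: vector_space "\<lambda>c x. \<phi> c * x"
    by (rule vector_space_scale)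
  define B where "B = vs.extend_basis {}"
  have B: "vs.independent B" "vs.span B = UNIV"
    unfolding B_def by (simp_all add: vs.independent_extend_basis vs.independent_empty)
  let ?R = "vs.representation B"
  have sum_R: "(\<Sum>b\<in>B. \<phi> (?R x b) * b) = x" for x
    using B by (intro vs.sum_representation_eq) auto
  have R_sum: "?R (\<Sum>b\<in>B. \<phi> (f b) * b) b = f b" if "b \<in> B" for f b
    using B that by (simp add: vs.representation_sum vs.representation_scale
        vs.representation_basis if_distrib[of "(*) _"] sum.delta' cong: if_cong)
  have "bij_betw (\<lambda>f. \<Sum>b\<in>B. \<phi> (f b) * b) (B \<rightarrow>\<^sub>E UNIV) UNIV"
  proof (rule bij_betw_byWitness[where f' = "\<lambda>x. restrict (?R x) B"])
    show "\<forall>f\<in>B \<rightarrow>\<^sub>E UNIV. restrict (?R (\<Sum>b\<in>B. \<phi> (f b) * b)) B = f"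
      by (auto simp: R_sum PiE_def extensional_def restrict_def)
    show "\<forall>x\<in>UNIV. (\<Sum>b\<in>B. \<phi> (restrict (?R x) B b) * b) = x"
      by (simp add: sum_R)
  qed auto
  then have "CARD('q) ^ card B = CARD('q) ^ m"
    using bij_betw_same_card[of _ "B \<rightarrow>\<^sub>E (UNIV :: 'q set)" "UNIV :: 'Q set"] assms(2)
    by (simp add: card_PiE)
  moreover have "CARD('q) > 1"
    using card_mono[of UNIV "{0, 1::'q}"] by simp
  ultimately have "card B = m"
    by simp
  then obtain h where h: "bij_betw h {0..<m} B"
    using ex_bij_betw_nat_finite[of B] by auto
  have "restriction_of_scalars \<phi> m (\<lambda>x i. ?R x (h i))"
  proof
    fix x assume "\<And>i. i < m \<Longrightarrow> ?R x (h i) = 0"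
    then have "?R x b = 0" if "b \<in> B" for b
      using h that by (auto simp: bij_betw_def)
    then show "x = 0"
      using sum_R[of x] by simp
  qed (use B in \<open>simp_all add: vs.representation_add vs.representation_scale\<close>)
  then show ?thesis
    by (rule that)
qed

context restriction_of_scalars
begin

lemma coord_0 [simp]: "coord 0 i = 0"
  by (metis add_cancel_left_left add_0 coord_add)

lemma coord_sum: "coord (sum f A) i = (\<Sum>a\<in>A. coord (f a) i)"
  by (induction A rule: infinite_finite_induct) (simp_all add: coord_add)

definition expand_vec :: "'Q vec \<Rightarrow> 'q vec" where
  "expand_vec v = vec (m * dim_vec v) (\<lambda>i. coord (v $ (i div m)) (i mod m))"

text \<open>Each entry becomes a vertical block of \<open>m\<close> cells, so the top
  \<open>g\<close> cells of a column become its top \<open>m * g\<close> cells, as the scaled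
  diagram demands.\<close>

definition expand_mat :: "'Q mat \<Rightarrow> 'q mat" where
  "expand_mat A = mat (m * dim_row A) (dim_col A) (\<lambda>(i, j). coord (A $$ (i div m, j)) (i mod m))"

lemma expand_mat_carrier [simp]:
  "A \<in> carrier_mat nr nc \<Longrightarrow> expand_mat A \<in> carrier_mat (m * nr) nc"
  by (simp add: expand_mat_def)

lemma expand_mat_add:
  "A \<in> carrier_mat nr nc \<Longrightarrow> B \<in> carrier_mat nr nc \<Longrightarrow>
    expand_mat (A + B) = expand_mat A + expand_mat B"
  by (auto simp: expand_mat_def coord_add div_less_of_less_mult)

lemma expand_mat_smult: "expand_mat (\<phi> c \<cdot>\<^sub>m A) = c \<cdot>\<^sub>m expand_mat A"
  by (auto simp: expand_mat_def coord_scale div_less_of_less_mult)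

lemma col_expand_mat: "j < dim_col A \<Longrightarrow> col (expand_mat A) j = expand_vec (col A j)"
  by (auto simp: expand_mat_def expand_vec_def div_less_of_less_mult)

lemma index_expand_vec:
  "i < dim_vec v \<Longrightarrow> k < m \<Longrightarrow> expand_vec v $ (i * m + k) = coord (v $ i) k"
  by (simp add: expand_vec_def mult_add_less_mult)

lemma coord_diff: "coord (x - y) i = coord x i - coord y i"
  using coord_add[of "x - y" y i] by (simp add: algebra_simps)

text \<open>Ranks are witnessed by sets of columns, so distinct columns have to stay
  distinct.\<close>

lemma inj_on_expand_vec: "inj_on expand_vec (carrier_vec k)"
proof (rule inj_onI, rule eq_vecI)
  fix v w :: "'Q vec" and i
  assume vw: "v \<in> carrier_vec k" "w \<in> carrier_vec k" "expand_vec v = expand_vec w"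
    and i: "i < dim_vec w"
  have "v $ i - w $ i = 0"
  proof (rule coord_eq_0)
    fix j assume "j < m"
    then show "coord (v $ i - w $ i) j = 0"
      using vw i index_expand_vec[of i v j] index_expand_vec[of i w j] by (simp add: coord_diff)
  qed
  then show "v $ i = w $ i"
    by simp
qed auto

text \<open>A relation over \<open>'q\<close> among expanded columns lifts, by applying \<phi> to
  its coefficients, to a relation over \<open>'Q\<close> among the original ones. That one is
  trivial, and \<phi> is injective.\<close>

lemma rank_le_rank_expand_mat:
  assumes A: "A \<in> carrier_mat nr nc"
  shows "vec_space.rank nr A \<le> vec_space.rank (m * nr) (expand_mat A)"
proof -
  interpret Q: vec_space "TYPE('Q)" nr .
  interpret q: vec_space "TYPE('q)" "m * nr" .
  obtain S where S: "S \<subseteq> set (cols A)" "Q.lin_indpt S" "card S = Q.rank A"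
    using Q.obtain_indpt_cols[OF A] by blast
  have fin: "finite S"
    using S(1) finite_subset by blast
  have S_carrier: "S \<subseteq> carrier_vec nr"
    using S(1) cols_dim[of A] A by auto
  have E_carrier: "expand_vec ` S \<subseteq> carrier_vec (m * nr)"
    using S_carrier by (auto simp: expand_vec_def)
  have inj: "inj_on expand_vec S"
    using inj_on_expand_vec S_carrier by (rule inj_on_subset)
  have "q.lin_indpt (expand_vec ` S)"
  proof (rule q.finite_lin_indpt2)
    fix c assume lc: "q.lincomb c (expand_vec ` S) = 0\<^sub>v (m * nr)"
    define d where "d v = \<phi> (c (expand_vec v))" for v
    have "Q.lincomb d S = 0\<^sub>v nr"
    proof (rule eq_vecI)
      fix i assume "i < dim_vec (0\<^sub>v nr :: 'Q vec)"
      then have i: "i < nr" by simp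
      \<comment> \<open>Checked coordinatewise: coordinate \<open>k\<close> of row \<open>i\<close>
        is row \<open>i * m + k\<close> of the given relation.\<close>
      have "(\<Sum>s\<in>S. d s * s $ i) = 0"
      proof (rule coord_eq_0)
        fix k assume k: "k < m"
        have ik: "i * m + k < m * nr"
          using i k by (rule mult_add_less_mult)
        have "coord (\<Sum>s\<in>S. d s * s $ i) k = (\<Sum>s\<in>S. c (expand_vec s) * coord (s $ i) k)"
          by (simp add: coord_sum d_def coord_scale)
        also have "\<dots> = (\<Sum>s\<in>S. c (expand_vec s) * expand_vec s $ (i * m + k))"
          using S_carrier i k by (intro sum.cong refl) (subst index_expand_vec, auto)
        also have "\<dots> = (\<Sum>u\<in>expand_vec ` S. c u * u $ (i * m + k))"
          by (simp add: sum.reindex[OF inj])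
        also have "\<dots> = q.lincomb c (expand_vec ` S) $ (i * m + k)"
          using q.lincomb_index[OF ik E_carrier] by simp
        also have "\<dots> = 0"
          using ik by (simp add: lc)
        finally show "coord (\<Sum>s\<in>S. d s * s $ i) k = 0" .
      qed
      then show "Q.lincomb d S $ i = 0\<^sub>v nr $ i"
        using Q.lincomb_index[OF i S_carrier] i by simp
    qed (use Q.lincomb_dim[OF fin S_carrier] in simp)
    then have "d v = 0" if "v \<in> S" for v
      using Q.lin_dep_crit[OF fin subset_refl, of v d] that S(2) by auto
    then show "\<forall>u\<in>expand_vec ` S. c u = 0"
      by (simp add: d_def)
  qed (use fin E_carrier in auto)
  moreover have "expand_vec ` S \<subseteq> set (cols (expand_mat A))"
  proof
    fix u assume "u \<in> expand_vec ` S"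
    then obtain j where "j < nc" "u = expand_vec (col A j)"
      using S(1) A by (auto simp: cols_def)
    then have "j < dim_col (expand_mat A)" "u = col (expand_mat A) j"
      using A by (simp_all add: col_expand_mat) (simp add: expand_mat_def)
    then show "u \<in> set (cols (expand_mat A))"
      by (simp add: cols_def)
  qed
  ultimately have "card (expand_vec ` S) \<le> q.rank (expand_mat A)"
    using A by (intro q.rank_ge_card_indpt[of _ nc]) simp_all
  then show ?thesis
    using S(3) card_image[OF inj] by simp
qed

text \<open>A discrete intermediate value argument. One \<open>t\<close> serves all codewords at
  once, so that clearing remains a linear map on the code.\<close>

lemma exact_distance_stage:
  assumes C: "C \<subseteq> carrier_mat a n" and dist: "min_rank_distance a n C \<delta>"
  obtains t where
    "\<And>M. M \<in> C - {0\<^sub>m a n} \<Longrightarrow>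
      \<delta> \<le> vec_space.rank (m * a) (zero_first_cols t (expand_mat M))"
    and "\<exists>M \<in> C - {0\<^sub>m a n}. vec_space.rank (m * a) (zero_first_cols t (expand_mat M)) = \<delta>"
proof -
  interpret Q: vec_space "TYPE('Q)" a .
  interpret q: vec_space "TYPE('q)" "m * a" .
  define P where
    "P t \<longleftrightarrow> (\<forall>M \<in> C - {0\<^sub>m a n}. \<delta> \<le> q.rank (zero_first_cols t (expand_mat M)))" for t
  have "P 0"
    unfolding P_def
  proof
    fix M assume M: "M \<in> C - {0\<^sub>m a n}"
    then have "\<delta> \<le> Q.rank M"
      using dist by (simp add: min_rank_distance_def nonzero_ranks_def)
    also have "\<dots> \<le> q.rank (expand_mat M)"
      using M C by (intro rank_le_rank_expand_mat[of M a n]) auto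
    finally show "\<delta> \<le> q.rank (zero_first_cols 0 (expand_mat M))"
      by simp
  qed
  moreover have "\<not> P n"
  proof -
    obtain M where M: "M \<in> C - {0\<^sub>m a n}" "\<delta> = Q.rank M"
      using dist by (auto simp: min_rank_distance_def nonzero_ranks_def)
    have "q.rank (zero_first_cols n (expand_mat M)) = 0"
      using M C zero_first_cols_all[of "expand_mat M" "m * a" n] q.rank_zero_mat by auto
    then show ?thesis
      using M(1) min_rank_distance_pos[OF C dist] unfolding P_def by (metis not_le)
  qed
  \<comment> \<open>At a stage where the bound is about to fail, a codeword of rank below \<delta>
    at \<open>Suc t\<close> has rank at most \<delta> at \<open>t\<close>, where \<open>P t\<close>
    still forces at least \<delta>.\<close>
  ultimately obtain t where t: "P t" "\<not> P (Suc t)"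
    using dec_induct[of 0 n P] by blast
  then obtain M where M: "M \<in> C - {0\<^sub>m a n}"
    "q.rank (zero_first_cols (Suc t) (expand_mat M)) < \<delta>"
    by (auto simp: P_def not_le)
  then have "q.rank (zero_first_cols t (expand_mat M)) \<le> \<delta>"
    using q.rank_zero_first_cols_Suc[of "expand_mat M" n t] C by auto
  moreover have "\<delta> \<le> q.rank (zero_first_cols t (expand_mat M))"
    using t(1) M(1) by (simp add: P_def)
  ultimately show ?thesis
    using that[of t] t(1) M(1) unfolding P_def by (metis antisym)
qed

end

section \<open>Counting codewords and assembling the new code\<close>

lemma finite_carrier_mat: "finite (carrier_mat nr nc :: 'a::finite mat set)"
proof (rule finite_subset)
  let ?F = "({..<nr} \<times> {..<nc}) \<rightarrow>\<^sub>E (UNIV :: 'a set)"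
  show "carrier_mat nr nc \<subseteq> mat nr nc ` ?F"
  proof
    fix A :: "'a mat" assume "A \<in> carrier_mat nr nc"
    then have "A = mat nr nc (restrict (($$) A) ({..<nr} \<times> {..<nc}))"
      by auto
    moreover have "restrict (($$) A) ({..<nr} \<times> {..<nc}) \<in> ?F"
      by auto
    ultimately show "A \<in> mat nr nc ` ?F"
      by (rule image_eqI)
  qed
  show "finite (mat nr nc ` ?F)"
    by (intro finite_imageI finite_PiE) auto
qed

lemma card_mat_subspace:
  fixes C :: "'a::{field,finite} mat set"
  assumes "VectorSpace.subspace class_ring C (module_mat TYPE('a) nr nc)"
  shows "card C = CARD('a) ^ vectorspace.dim class_ring ((module_mat TYPE('a) nr nc)\<lparr>carrier := C\<rparr>)"
proof -
  have "submodule class_ring C (module_mat TYPE('a) nr nc)"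
    using assms by (simp add: VectorSpace.subspace_def)
  then have "C \<subseteq> carrier_mat nr nc"
    using submodule.subset by (fastforce simp: module_mat_simps)
  then have "finite C"
    using finite_carrier_mat finite_subset by blast
  then show ?thesis
    using vectorspace.card_carrier_eq_power_dim[OF vectorspace.subspace_is_vs[OF matrix_vs assms]]
    by simp
qed

lemma zero_first_cols_add:
  "A \<in> carrier_mat nr nc \<Longrightarrow> B \<in> carrier_mat nr nc \<Longrightarrow>
    zero_first_cols t (A + B) = zero_first_cols t A + zero_first_cols t (B :: 'a::monoid_add mat)"
  by (auto simp: zero_first_cols_def)

lemma zero_first_cols_smult:
  "zero_first_cols t (c \<cdot>\<^sub>m A) = c \<cdot>\<^sub>m zero_first_cols t (A :: 'a::mult_zero mat)"
  by (auto simp: zero_first_cols_def)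

lemma ferrers_diagram_scale:
  assumes "ferrers_diagram a n \<gamma>" and "m > 0"
  shows "ferrers_diagram (m * a) n (map (\<lambda>g. m * g) \<gamma>)"
  using assms by (simp add: ferrers_diagram_def sorted_iff_nth_mono)

theorem theorem3p1:
  fixes q m a n k \<delta> :: nat and \<gamma> :: "nat list"
  assumes "primepow q" and "m > 0"
    and "CARD('q::{field,finite}) = q"
    and "CARD('Q::{field,finite}) = q ^ m"
    and "ferrers_diagram a n \<gamma>"
    and "\<exists>C :: 'Q mat set. ferrers_code a n \<gamma> k \<delta> C"
  shows "\<exists>C' :: 'q mat set. ferrers_code (m * a) n (map (\<lambda>g. m * g) \<gamma>) (m * k) \<delta> C'"
proof -
  have "primepow CARD('q)" and cards: "CARD('Q) = CARD('q) ^ m"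
    using assms by simp_all
  then obtain \<phi> :: "'q \<Rightarrow> 'Q" where "field_hom \<phi>"
    using finite_field_embedding by blast
  then obtain coord where "restriction_of_scalars \<phi> m coord"
    using cards restriction_of_scalars_exists by blast
  then interpret restriction_of_scalars \<phi> m coord .
  obtain C :: "'Q mat set" where
    sub: "VectorSpace.subspace class_ring C (module_mat TYPE('Q) a n)" and
    dim: "vectorspace.dim class_ring ((module_mat TYPE('Q) a n)\<lparr>carrier := C\<rparr>) = k" and
    dist: "min_rank_distance a n C \<delta>" and
    supp: "\<And>M i j. M \<in> C \<Longrightarrow> i < a \<Longrightarrow> j < n \<Longrightarrow> (i, j) \<notin> ferrers_dots \<gamma> \<Longrightarrow> M $$ (i, j) = 0"
    using assms(6) unfolding ferrers_code_def by blast
  have C: "submodule class_ring C (module_mat TYPE('Q) a n)"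
    using sub by (simp add: VectorSpace.subspace_def)
  have C_carrier: "C \<subseteq> carrier_mat a n" and C_zero: "0\<^sub>m a n \<in> C"
    using submodule.subset[OF C] submodule.zero_closed[OF C] by (simp_all add: module_mat_simps)
  have C_add: "A + B \<in> C" and C_smult: "c \<cdot>\<^sub>m A \<in> C" if "A \<in> C" "B \<in> C" for A B c
    using submodule.m_closed[OF C] submodule.smult_closed[OF C] that
    by (simp_all add: module_mat_simps)
  obtain t where
    t_le: "\<And>M. M \<in> C - {0\<^sub>m a n} \<Longrightarrow>
      \<delta> \<le> vec_space.rank (m * a) (zero_first_cols t (expand_mat M))" and
    t_eq: "\<exists>M \<in> C - {0\<^sub>m a n}. vec_space.rank (m * a) (zero_first_cols t (expand_mat M)) = \<delta>"
    using exact_distance_stage[OF C_carrier dist] by blast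
  define f where "f M = zero_first_cols t (expand_mat M)" for M
  have f_carrier: "f M \<in> carrier_mat (m * a) n" if "M \<in> C" for M
    using that C_carrier by (auto simp: f_def)
  have f_add: "f (A + B) = f A + f B" if "A \<in> C" "B \<in> C" for A B
  proof -
    have "A \<in> carrier_mat a n" "B \<in> carrier_mat a n"
      using that C_carrier by auto
    then show ?thesis
      by (simp add: f_def expand_mat_add[of A a n B]
          zero_first_cols_add[of "expand_mat A" "m * a" n "expand_mat B" t])
  qed
  have f_smult: "f (\<phi> c \<cdot>\<^sub>m A) = c \<cdot>\<^sub>m f A" for A c
    by (simp add: f_def expand_mat_smult zero_first_cols_smult)
  have f_zero: "f (0\<^sub>m a n) = 0\<^sub>m (m * a) n"
    by (auto simp: f_def zero_first_cols_def expand_mat_def div_less_of_less_mult)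
  \<comment> \<open>Nonzero codewords keep rank at least \<delta>, which is positive, so the kernel
    is trivial despite the cleared columns.\<close>
  have f_eq_0: "M = 0\<^sub>m a n" if "M \<in> C" "f M = 0\<^sub>m (m * a) n" for M
  proof (rule ccontr)
    assume "M \<noteq> 0\<^sub>m a n"
    then have "\<delta> \<le> vec_space.rank (m * a) (f M)"
      using t_le[of M] that(1) by (simp add: f_def)
    then show False
      using min_rank_distance_pos[OF C_carrier dist] by (simp add: that(2) vec_space.rank_zero_mat)
  qed
  have "inj_on f C"
  proof (rule inj_onI)
    fix A B assume AB: "A \<in> C" "B \<in> C" "f A = f B"
    have carr: "A \<in> carrier_mat a n" "B \<in> carrier_mat a n"
      using AB C_carrier by auto
    \<comment> \<open>This is the difference of \<open>A\<close> and \<open>B\<close>, in a form to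
      which \<open>f_add\<close> and \<open>f_smult\<close> apply directly.\<close>
    let ?D = "A + \<phi> (- 1) \<cdot>\<^sub>m B"
    have "f ?D = f A + (- 1) \<cdot>\<^sub>m f B"
      using AB by (simp only: f_add[OF AB(1) C_smult[OF AB(2,2)]] f_smult)
    also have "\<dots> = 0\<^sub>m (m * a) n"
      using f_carrier[OF AB(2)] unfolding AB(3) by (intro eq_matI) auto
    finally have "?D = 0\<^sub>m a n"
      using AB by (intro f_eq_0 C_add C_smult)
    show "A = B"
    proof (rule eq_matI)
      fix i j assume "i < dim_row B" "j < dim_col B"
      moreover from this have "?D $$ (i, j) = 0"
        using \<open>?D = 0\<^sub>m a n\<close> carr by simp
      ultimately show "A $$ (i, j) = B $$ (i, j)"
        using carr by (simp add: hom_uminus)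
    qed (use carr in auto)
  qed
  define C' where "C' = f ` C"
  have sub': "VectorSpace.subspace class_ring C' (module_mat TYPE('q) (m * a) n)"
    unfolding VectorSpace.subspace_def
  proof
    show "vectorspace class_ring (module_mat TYPE('q) (m * a) n)"
      by (rule matrix_vs)
    then have "Module.module class_ring (module_mat TYPE('q) (m * a) n)"
      by (simp add: vectorspace_def)
    moreover have "c \<cdot>\<^sub>m f A \<in> f ` C" if "A \<in> C" for A c
      using C_smult[OF that that, of "\<phi> c"] f_smult[of c A] by (metis image_eqI)
    moreover have "f A + f B \<in> f ` C" if "A \<in> C" "B \<in> C" for A B
      using C_add[OF that] f_add[OF that] by (metis image_eqI)
    moreover have "0\<^sub>m (m * a) n \<in> f ` C"
      using C_zero f_zero by (metis image_eqI)
    ultimately show "submodule class_ring C' (module_mat TYPE('q) (m * a) n)"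
      using f_carrier by (auto simp: submodule_def module_mat_simps C'_def)
  qed
  \<comment> \<open>By injectivity both codes have the same size, \<open>CARD('Q) ^ k\<close>, which
    is \<open>CARD('q) ^ (m * k)\<close>.\<close>
  have "CARD('q) ^ vectorspace.dim class_ring ((module_mat TYPE('q) (m * a) n)\<lparr>carrier := C'\<rparr>)
    = CARD('q) ^ (m * k)"
    using card_mat_subspace[OF sub] card_mat_subspace[OF sub'] card_image[OF \<open>inj_on f C\<close>]
    by (simp add: C'_def dim cards power_mult)
  moreover have "CARD('q) > 1"
    using card_mono[of UNIV "{0, 1::'q}"] by simp
  ultimately have dim':
    "vectorspace.dim class_ring ((module_mat TYPE('q) (m * a) n)\<lparr>carrier := C'\<rparr>) = m * k"
    by simp
  have "C' - {0\<^sub>m (m * a) n} = f ` (C - {0\<^sub>m a n})"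
    using f_eq_0 f_zero by (auto simp: C'_def)
  then have dist': "min_rank_distance (m * a) n C' \<delta>"
    using t_le t_eq by (auto simp: min_rank_distance_def nonzero_ranks_def f_def)
  have supp': "M $$ (i, j) = 0"
    if M: "M \<in> C'" "i < m * a" "j < n" "(i, j) \<notin> ferrers_dots (map (\<lambda>g. m * g) \<gamma>)" for M i j
  proof -
    obtain A where A: "A \<in> C" "M = f A"
      using M(1) by (auto simp: C'_def)
    have "length \<gamma> = n"
      using assms(5) by (simp add: ferrers_diagram_def)
    \<comment> \<open>If \<open>i\<close> is at least \<open>m * \<gamma> ! j\<close>, then its
      block index \<open>i div m\<close> is at least \<open>\<gamma> ! j\<close>. Clearing columns
      only adds zeros.\<close>
    then have "(i div m, j) \<notin> ferrers_dots \<gamma>"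
      using M(3,4) \<open>m > 0\<close>
      by (auto simp: ferrers_dots_def div_less_iff_less_mult mult.commute)
    then have "A $$ (i div m, j) = 0"
      using supp[OF A(1)] M(2,3) div_less_of_less_mult by blast
    then show ?thesis
      using A C_carrier M(2,3) by (auto simp: f_def zero_first_cols_def expand_mat_def)
  qed
  show ?thesis
    unfolding ferrers_code_def
    using ferrers_diagram_scale[OF assms(5,2)] sub' dim' dist' supp' by blast
qed

end
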